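(* Let $X_i=u_{i,1}\partial_1+u_{i,2}\partial_2\in \mathrm{Vect}(2)$, $i=1,\ldots,6$. For symbols $\rho_3,\ldots,\rho_6$ of the form $Pu_j$, where $j\in\{1,2\}$ and $P$ is a monomial in $\partial_1,\partial_2$, let $\Delta(\rho_3,\rho_4,\rho_5,\rho_6)$ denote the determinant of the $6\times6$ matrix whose first row is $(u_{1,1},\ldots,u_{6,1})$, whose second row is $(u_{1,2},\ldots,u_{6,2})$, and whose $r$-th row, $r=3,\ldots,6$, is $(Pu_{1,j},\ldots,Pu_{6,j})$ if $\rho_r=Pu_j$. Let $\Delta'(\rho_3,\rho_4,\rho_5,\rho_6)$ denote the determinant of the same matrix with its first two rows interchanged, i.e. with first row $(u_{1,2},\ldots,u_{6,2})$ and second row $(u_{1,1},\ldots,u_{6,1})$. Then $$s_6(X_1,\ldots,X_6)=F_1\,\partial_1+F_2\,\partial_2,$$ where $$\begin{aligned}F_1=&-\Delta(\partial_2u_1,\partial_1u_2,\partial_2u_2,\partial_2^2u_2)-\Delta(\partial_1u_1,\partial_2u_1,\partial_2u_2,\partial_1^2u_1)-\Delta(\partial_1u_1,\partial_2u_1,\partial_1u_2,\partial_2^2u_2)\\ &+2\Delta(\partial_2u_1,\partial_1u_2,\partial_2u_2,\partial_1\partial_2u_1)+2\Delta(\partial_1u_1,\partial_2u_1,\partial_1u_2,\partial_1\partial_2u_1)+2\Delta(\partial_1u_1,\partial_2u_1,\partial_2u_2,\partial_1\partial_2u_2)\\ &-3\Delta(\partial_1u_1,\partial_1u_2,\partial_2u_2,\partial_2^2u_1),\end{aligned}$$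 and $F_2$ is obtained from $F_1$ by interchanging the indices $1$ and $2$ (of derivations and of components): $$\begin{aligned}F_2=&-\Delta'(\partial_1u_2,\partial_2u_1,\partial_1u_1,\partial_1^2u_1)-\Delta'(\partial_2u_2,\partial_1u_2,\partial_1u_1,\partial_2^2u_2)-\Delta'(\partial_2u_2,\partial_1u_2,\partial_2u_1,\partial_1^2u_1)\\ &+2\Delta'(\partial_1u_2,\partial_2u_1,\partial_1u_1,\partial_1\partial_2u_2)+2\Delta'(\partial_2u_2,\partial_1u_2,\partial_2u_1,\partial_1\partial_2u_2)+2\Delta'(\partial_2u_2,\partial_1u_2,\partial_1u_1,\partial_1\partial_2u_1)\\ &-3\Delta'(\partial_2u_2,\partial_2u_1,\partial_1u_1,\partial_1^2u_2).\end{aligned}$$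
   Context: Let $U=\mathbb{C}[x_1,x_2]$, $\partial_i=\partial/\partial x_i$, and let $\mathrm{Diff}(2)$ be the space of differential operators $\sum_\alpha u_\alpha\partial^\alpha$ (finite sums, $u_\alpha\in U$). Operators are written as acting on the right, and the associative product $X\cdot Y$ is composition in the order "first $X$, then $Y$"; thus $u\partial_i\cdot v\partial_j=v\,\partial_j(u)\,\partial_i+uv\,\partial_i\partial_j$. $\mathrm{Vect}(2)=\{u_1\partial_1+u_2\partial_2:u_1,u_2\in U\}\subseteq\mathrm{Diff}(2)$. $s_6(X_1,\ldots,X_6)=\sum_{\sigma\in \mathrm{Sym}_6}\mathrm{sign}(\sigma)\,X_{\sigma(1)}\cdot X_{\sigma(2)}\cdots X_{\sigma(6)}$, computed in $\mathrm{Diff}(2)$. *)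

theory Defs
  imports
    "HOL-Computational_Algebra.Polynomial"
    "HOL-Combinatorics.Permutations"
    "Jordan_Normal_Form.Determinant"
begin

section \<open>Polynomials in two variables\<close>

text \<open>
  The ring \<open>\<complex>[x\<^sub>1, x\<^sub>2]\<close> is represented as \<open>(\<complex>[x\<^sub>1])[x\<^sub>2]\<close>: the inner variable, \<open>[:[:0, 1:]:]\<close>,
  is \<open>x\<^sub>1\<close> and the outer variable, \<open>[:0, 1:]\<close>, is \<open>x\<^sub>2\<close>.
\<close>

type_synonym poly2 = "complex poly poly"

definition pd1 :: "poly2 \<Rightarrow> poly2" where
  "pd1 = map_poly pderiv"

definition pd2 :: "poly2 \<Rightarrow> poly2" where
  "pd2 = pderiv"

text \<open>The exponent pair \<open>(a, b)\<close> stands for the monomial \<open>\<partial>\<^sub>1\<^sup>a \<partial>\<^sub>2\<^sup>b\<close>.\<close>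

definition pd :: "nat \<times> nat \<Rightarrow> poly2 \<Rightarrow> poly2" where
  "pd \<alpha> f = (pd1 ^^ fst \<alpha>) ((pd2 ^^ snd \<alpha>) f)"

lemma coeff_pd1: "coeff (pd1 f) n = pderiv (coeff f n)"
  by (simp add: pd1_def coeff_map_poly)

lemma pd1_vars: "pd1 [:[:0, 1:]:] = 1" "pd1 [:0, 1:] = 0"
  by (auto simp: pd1_def map_poly_pCons pderiv_pCons one_pCons)

lemma pd2_vars: "pd2 [:[:0, 1:]:] = 0" "pd2 [:0, 1:] = 1"
  by (auto simp: pd2_def pderiv_pCons one_pCons)

lemma pd1_add: "pd1 (f + g) = pd1 f + pd1 g"
  by (rule poly_eqI) (simp add: coeff_pd1 pderiv_add)

lemma pd2_add: "pd2 (f + g) = pd2 f + pd2 g"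
  by (simp add: pd2_def pderiv_add)

lemma pd1_0 [simp]: "pd1 0 = 0" and pd2_0 [simp]: "pd2 0 = 0"
  by (simp_all add: pd1_def pd2_def)

lemma pderiv_sum': "pderiv (sum f A) = (\<Sum>i\<in>A. pderiv (f i))"
  for f :: "'i \<Rightarrow> complex poly"
  by (induction A rule: infinite_finite_induct) (auto simp: pderiv_add)

lemma pd1_mult: "pd1 (f * g) = pd1 f * g + f * pd1 g"
proof (rule poly_eqI)
  have *: "pderiv (p * q) = pderiv p * q + p * pderiv q" for p q :: "complex poly"
    by (simp add: pderiv_mult mult.commute)
  show "coeff (pd1 (f * g)) n = coeff (pd1 f * g + f * pd1 g) n" for n
    by (simp add: coeff_pd1 coeff_mult pderiv_sum' * sum.distrib)
qed

lemma pd2_mult: "pd2 (f * g) = pd2 f * g + f * pd2 g"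
  by (simp add: pd2_def pderiv_mult algebra_simps)

lemma pd1_pd2: "pd2 (pd1 f) = pd1 (pd2 f)"
proof (rule poly_eqI)
  fix n
  have *: "pderiv (of_nat k * q) = of_nat k * pderiv q" for k and q :: "complex poly"
    by (simp add: pderiv_mult pderiv_of_nat)
  show "coeff (pd2 (pd1 f)) n = coeff (pd1 (pd2 f)) n"
    using *[of "Suc n" "coeff f (Suc n)"]
    by (simp add: pd2_def coeff_pd1 coeff_pderiv del: of_nat_Suc)
qed

lemma pd1_sum: "pd1 (sum f A) = (\<Sum>i\<in>A. pd1 (f i))"
  by (induction A rule: infinite_finite_induct) (auto simp: pd1_add)

lemma pd2_sum: "pd2 (sum f A) = (\<Sum>i\<in>A. pd2 (f i))"
  by (induction A rule: infinite_finite_induct) (auto simp: pd2_add)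

lemma pd_0_0 [simp]: "pd (0, 0) f = f"
  by (simp add: pd_def)

lemma pd_zero [simp]: "pd \<alpha> 0 = 0"
proof -
  have "(pd1 ^^ n) 0 = 0" "(pd2 ^^ n) 0 = 0" for n
    by (induction n) auto
  then show ?thesis by (simp add: pd_def)
qed

lemma pd_add: "pd \<alpha> (f + g) = pd \<alpha> f + pd \<alpha> g"
proof -
  have "(pd1 ^^ n) (f + g) = (pd1 ^^ n) f + (pd1 ^^ n) g" for n f g
    by (induction n) (auto simp: pd1_add)
  moreover have "(pd2 ^^ n) (f + g) = (pd2 ^^ n) f + (pd2 ^^ n) g" for n f g
    by (induction n) (auto simp: pd2_add)
  ultimately show ?thesis by (simp add: pd_def)
qed

lemma pd1_pd: "pd1 (pd \<alpha> f) = pd (Suc (fst \<alpha>), snd \<alpha>) f"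
  by (simp add: pd_def)

lemma pd2_pd: "pd2 (pd \<alpha> f) = pd (fst \<alpha>, Suc (snd \<alpha>)) f"
proof -
  have "pd2 ((pd1 ^^ n) g) = (pd1 ^^ n) (pd2 g)" for n g
    by (induction n) (auto simp: pd1_pd2)
  then show ?thesis by (simp add: pd_def)
qed


section \<open>Differential operators\<close>

text \<open>
  An operator is identified with its action on \<open>\<complex>[x\<^sub>1, x\<^sub>2]\<close>. In characteristic 0 this action
  determines the coefficients of \<open>\<Sum>\<alpha>. u\<^sub>\<alpha> \<partial>\<^sup>\<alpha>\<close>.
\<close>

definition Diff2 :: "(poly2 \<Rightarrow> poly2) set" where
  "Diff2 = {T. \<exists>A u. finite A \<and> T = (\<lambda>f. \<Sum>\<alpha>\<in>A. u \<alpha> * pd \<alpha> f)}"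

lemma Diff2_monom: "(\<lambda>f. u * pd \<alpha> f) \<in> Diff2"
  unfolding Diff2_def by (intro CollectI exI[of _ "{\<alpha>}"] exI[of _ "\<lambda>_. u"]) auto

lemma Diff2_zero: "(\<lambda>f. 0) \<in> Diff2"
  using Diff2_monom[of 0] by simp

lemma Diff2_add:
  assumes "S \<in> Diff2" "T \<in> Diff2"
  shows "(\<lambda>f. S f + T f) \<in> Diff2"
proof -
  obtain A u where A: "finite A" "S = (\<lambda>f. \<Sum>\<alpha>\<in>A. u \<alpha> * pd \<alpha> f)"
    using assms(1) unfolding Diff2_def by blast
  obtain B v where B: "finite B" "T = (\<lambda>f. \<Sum>\<alpha>\<in>B. v \<alpha> * pd \<alpha> f)"
    using assms(2) unfolding Diff2_def by blast
  define w where "w \<alpha> = (if \<alpha> \<in> A then u \<alpha> else 0) + (if \<alpha> \<in> B then v \<alpha> else 0)" for \<alpha>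
  have "S f + T f = (\<Sum>\<alpha>\<in>A \<union> B. w \<alpha> * pd \<alpha> f)" for f
  proof -
    have "S f = (\<Sum>\<alpha>\<in>A \<union> B. (if \<alpha> \<in> A then u \<alpha> else 0) * pd \<alpha> f)"
      unfolding A(2) by (rule sum.mono_neutral_cong_left) (use A(1) B(1) in auto)
    moreover have "T f = (\<Sum>\<alpha>\<in>A \<union> B. (if \<alpha> \<in> B then v \<alpha> else 0) * pd \<alpha> f)"
      unfolding B(2) by (rule sum.mono_neutral_cong_left) (use A(1) B(1) in auto)
    ultimately show ?thesis
      by (simp add: w_def distrib_right sum.distrib)
  qed
  then show ?thesis
    unfolding Diff2_def using A(1) B(1)
    by (intro CollectI exI[of _ "A \<union> B"] exI[of _ w]) auto
qed

lemma Diff2_sum: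
  assumes "\<And>i. i \<in> I \<Longrightarrow> T i \<in> Diff2"
  shows "(\<lambda>f. \<Sum>i\<in>I. T i f) \<in> Diff2"
  using assms
  by (induction I rule: infinite_finite_induct) (auto intro: Diff2_zero Diff2_add)

lemma Diff2_scale:
  assumes "T \<in> Diff2"
  shows "(\<lambda>f. u * T f) \<in> Diff2"
proof -
  obtain A v where A: "finite A" "T = (\<lambda>f. \<Sum>\<alpha>\<in>A. v \<alpha> * pd \<alpha> f)"
    using assms unfolding Diff2_def by blast
  have "(\<lambda>f. u * T f) = (\<lambda>f. \<Sum>\<alpha>\<in>A. (u * v \<alpha>) * pd \<alpha> f)"
    by (simp add: A(2) sum_distrib_left mult.assoc)
  then show ?thesis
    unfolding Diff2_def using A(1) by (intro CollectI exI conjI)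
qed

lemma Diff2_uminus:
  assumes "T \<in> Diff2"
  shows "(\<lambda>f. - T f) \<in> Diff2"
  using Diff2_scale[OF assms, of "-1"] by simp

lemma Diff2_pd1:
  assumes "T \<in> Diff2"
  shows "(\<lambda>f. pd1 (T f)) \<in> Diff2"
proof -
  obtain A u where A: "T = (\<lambda>f. \<Sum>\<alpha>\<in>A. u \<alpha> * pd \<alpha> f)"
    using assms unfolding Diff2_def by blast
  have "(\<lambda>f. pd1 (T f)) =
      (\<lambda>f. \<Sum>\<alpha>\<in>A. pd1 (u \<alpha>) * pd \<alpha> f + u \<alpha> * pd (Suc (fst \<alpha>), snd \<alpha>) f)"
    by (simp add: A pd1_sum pd1_mult pd1_pd)
  also have "\<dots> \<in> Diff2"
    by (intro Diff2_sum Diff2_add Diff2_monom)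
  finally show ?thesis .
qed

lemma Diff2_pd2:
  assumes "T \<in> Diff2"
  shows "(\<lambda>f. pd2 (T f)) \<in> Diff2"
proof -
  obtain A u where A: "T = (\<lambda>f. \<Sum>\<alpha>\<in>A. u \<alpha> * pd \<alpha> f)"
    using assms unfolding Diff2_def by blast
  have "(\<lambda>f. pd2 (T f)) =
      (\<lambda>f. \<Sum>\<alpha>\<in>A. pd2 (u \<alpha>) * pd \<alpha> f + u \<alpha> * pd (fst \<alpha>, Suc (snd \<alpha>)) f)"
    by (simp add: A pd2_sum pd2_mult pd2_pd)
  also have "\<dots> \<in> Diff2"
    by (intro Diff2_sum Diff2_add Diff2_monom)
  finally show ?thesis .
qed

lemma Diff2_pd:
  assumes "T \<in> Diff2"
  shows "(\<lambda>f. pd \<alpha> (T f)) \<in> Diff2"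
proof -
  have 2: "(\<lambda>f. (pd2 ^^ n) (T f)) \<in> Diff2" for n
    by (induction n) (auto simp: assms intro: Diff2_pd2)
  have "(\<lambda>f. (pd1 ^^ m) ((pd2 ^^ n) (T f))) \<in> Diff2" for m n
    by (induction m) (auto simp: 2 intro: Diff2_pd1)
  then show ?thesis by (simp add: pd_def)
qed

lemma Diff2_comp:
  assumes "S \<in> Diff2" "T \<in> Diff2"
  shows "(\<lambda>f. S (T f)) \<in> Diff2"
proof -
  obtain A u where A: "S = (\<lambda>f. \<Sum>\<alpha>\<in>A. u \<alpha> * pd \<alpha> f)"
    using assms(1) unfolding Diff2_def by blast
  show ?thesis
    unfolding A by (intro Diff2_sum Diff2_scale Diff2_pd assms(2))
qed

lemma Diff2_additive:
  assumes "T \<in> Diff2"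
  shows "T (f + g) = T f + T g"
  using assms unfolding Diff2_def
  by (auto simp: pd_add distrib_left sum.distrib)

lemma Diff2_at_0:
  assumes "T \<in> Diff2"
  shows "T 0 = 0"
  using Diff2_additive[OF assms, of 0 0] by simp

typedef diff2 = Diff2
  morphisms apply_diff Abs_diff2
  using Diff2_zero by blast

setup_lifting type_definition_diff2

text \<open>
  Operators act on the right: the product \<open>X * Y\<close> is "first \<open>X\<close>, then \<open>Y\<close>", so as a map on
  polynomials it is the composite \<open>Y \<circ> X\<close>.
\<close>

instantiation diff2 :: ring_1
begin

lift_definition zero_diff2 :: diff2 is "\<lambda>f. 0" by (rule Diff2_zero)
lift_definition one_diff2 :: diff2 is "\<lambda>f. f" using Diff2_monom[of 1 "(0, 0)"] by simp
lift_definition plus_diff2 :: "diff2 \<Rightarrow> diff2 \<Rightarrow> diff2" is "\<lambda>X Y f. X f + Y f"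
  by (rule Diff2_add)
lift_definition uminus_diff2 :: "diff2 \<Rightarrow> diff2" is "\<lambda>X f. - X f"
  by (rule Diff2_uminus)
lift_definition minus_diff2 :: "diff2 \<Rightarrow> diff2 \<Rightarrow> diff2" is "\<lambda>X Y f. X f - Y f"
  using Diff2_add[OF _ Diff2_uminus] by simp
lift_definition times_diff2 :: "diff2 \<Rightarrow> diff2 \<Rightarrow> diff2" is "\<lambda>X Y f. Y (X f)"
  by (rule Diff2_comp)

instance
proof
  show "(0 :: diff2) \<noteq> 1"
    by transfer (metis one_neq_zero)
qed (transfer; auto simp: Diff2_additive fun_eq_iff)+

end

text \<open>The left \<open>\<complex>[x\<^sub>1, x\<^sub>2]\<close>-module structure: in \<open>u *\<^sub>D X\<close> the result of \<open>X\<close> is multiplied by \<open>u\<close>.\<close>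

definition scale_diff :: "poly2 \<Rightarrow> diff2 \<Rightarrow> diff2"  (infixr \<open>*\<^sub>D\<close> 75) where
  "u *\<^sub>D X = Abs_diff2 (\<lambda>f. u * apply_diff X f)"

lift_definition diff_D1 :: diff2  (\<open>\<partial>\<^sub>1\<close>) is pd1
  using Diff2_monom[of 1 "(1, 0)"] by (simp add: pd_def)

lift_definition diff_D2 :: diff2  (\<open>\<partial>\<^sub>2\<close>) is pd2
  using Diff2_monom[of 1 "(0, 1)"] by (simp add: pd_def)

lemma apply_diff_simps [simp]:
  "apply_diff 0 f = 0"
  "apply_diff 1 f = f"
  "apply_diff (X + Y) f = apply_diff X f + apply_diff Y f"
  "apply_diff (- X) f = - apply_diff X f"
  "apply_diff (X - Y) f = apply_diff X f - apply_diff Y f"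
  "apply_diff (X * Y) f = apply_diff Y (apply_diff X f)"
  "apply_diff \<partial>\<^sub>1 f = pd1 f"
  "apply_diff \<partial>\<^sub>2 f = pd2 f"
  by (simp_all add: zero_diff2.rep_eq one_diff2.rep_eq plus_diff2.rep_eq uminus_diff2.rep_eq
      minus_diff2.rep_eq times_diff2.rep_eq diff_D1.rep_eq diff_D2.rep_eq)

lemma apply_scale_diff [simp]: "apply_diff (u *\<^sub>D X) f = u * apply_diff X f"
  using Diff2_scale[OF apply_diff, of u X] by (simp add: scale_diff_def Abs_diff2_inverse)

lemma diff2_eqI: "(\<And>f. apply_diff X f = apply_diff Y f) \<Longrightarrow> X = Y"
  by (simp add: apply_diff_inject[symmetric] fun_eq_iff)

lemma scale_diff_mult_D1:
  "(u *\<^sub>D X) * (v *\<^sub>D \<partial>\<^sub>1) = (v * pd1 u) *\<^sub>D X + (u * v) *\<^sub>D (X * \<partial>\<^sub>1)"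
  by (rule diff2_eqI) (simp add: pd1_mult algebra_simps)

lemma scale_diff_mult_D2:
  "(u *\<^sub>D X) * (v *\<^sub>D \<partial>\<^sub>2) = (v * pd2 u) *\<^sub>D X + (u * v) *\<^sub>D (X * \<partial>\<^sub>2)"
  by (rule diff2_eqI) (simp add: pd2_mult algebra_simps)


section \<open>The skew-symmetric sum and the determinants\<close>

definition s6 :: "(nat \<Rightarrow> 'a::ring_1) \<Rightarrow> 'a" where
  "s6 X = (\<Sum>\<sigma> | \<sigma> permutes {1..6}. of_int (sign \<sigma>) *
     (X (\<sigma> 1) * X (\<sigma> 2) * X (\<sigma> 3) * X (\<sigma> 4) * X (\<sigma> 5) * X (\<sigma> 6)))"

text \<open>
  The symbol \<open>((a, b), j)\<close> stands for \<open>\<partial>\<^sub>1\<^sup>a \<partial>\<^sub>2\<^sup>b u\<^sub>j\<close> with \<open>j \<in> {1, 2}\<close>. The polynomial \<open>u i j\<close> is the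
  component \<open>u\<^sub>i\<^sub>,\<^sub>j\<close>; only \<open>i \<in> {1..6}\<close> and \<open>j \<in> {1, 2}\<close> are relevant.
\<close>

type_synonym diff_symbol = "(nat \<times> nat) \<times> nat"

definition symbol_row :: "(nat \<Rightarrow> nat \<Rightarrow> poly2) \<Rightarrow> diff_symbol \<Rightarrow> poly2 list" where
  "symbol_row u \<rho> = map (\<lambda>i. pd (fst \<rho>) (u i (snd \<rho>))) [1..<7]"

definition Delta ::
  "(nat \<Rightarrow> nat \<Rightarrow> poly2) \<Rightarrow> diff_symbol \<Rightarrow> diff_symbol \<Rightarrow> diff_symbol \<Rightarrow> diff_symbol \<Rightarrow> poly2" where
  "Delta u \<rho>\<^sub>3 \<rho>\<^sub>4 \<rho>\<^sub>5 \<rho>\<^sub>6 = det (mat_of_rows_list 6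
     [map (\<lambda>i. u i 1) [1..<7], map (\<lambda>i. u i 2) [1..<7],
      symbol_row u \<rho>\<^sub>3, symbol_row u \<rho>\<^sub>4, symbol_row u \<rho>\<^sub>5, symbol_row u \<rho>\<^sub>6])"

definition Delta' ::
  "(nat \<Rightarrow> nat \<Rightarrow> poly2) \<Rightarrow> diff_symbol \<Rightarrow> diff_symbol \<Rightarrow> diff_symbol \<Rightarrow> diff_symbol \<Rightarrow> poly2" where
  "Delta' u \<rho>\<^sub>3 \<rho>\<^sub>4 \<rho>\<^sub>5 \<rho>\<^sub>6 = det (mat_of_rows_list 6
     [map (\<lambda>i. u i 2) [1..<7], map (\<lambda>i. u i 1) [1..<7],
      symbol_row u \<rho>\<^sub>3, symbol_row u \<rho>\<^sub>4, symbol_row u \<rho>\<^sub>5, symbol_row u \<rho>\<^sub>6])"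

end

theory Submission
  imports Defs "HOL-Library.Function_Algebras"
begin

text \<open>
  The skew-symmetric sum is turned into a power of a single odd operator. Adjoin anticommuting
  generators \<open>\<theta>\<^sub>1, \<dots>, \<theta>\<^sub>6\<close> that commute with all differential operators, and put
  \<open>V = \<Sum>i. X\<^sub>i \<theta>\<^sub>i\<close>. Then \<open>V\<^sup>6 = s\<^sub>6(X\<^sub>1, \<dots>, X\<^sub>6) \<theta>\<^sub>1 \<cdots> \<theta>\<^sub>6\<close> (lemma \<open>s6_as_power\<close>). On the other
  hand \<open>V = \<partial>\<^sub>1 u + \<partial>\<^sub>2 v\<close> (the left factor of a product acts first), where \<open>u = \<Sum>i. u\<^sub>i\<^sub>,\<^sub>1 \<theta>\<^sub>i\<close> and \<open>v = \<Sum>i. u\<^sub>i\<^sub>,\<^sub>2 \<theta>\<^sub>i\<close> are odd, that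
  is, all derivatives of \<open>u\<close> and \<open>v\<close> anticommute and square to zero.

  For an odd vector field the second-order part of \<open>V\<^sup>2\<close> vanishes, so \<open>V\<^sup>2\<close> is an even vector field
  \<open>E = \<partial>\<^sub>1 a + \<partial>\<^sub>2 b\<close>, with \<open>a = \<partial>\<^sub>1(u) u + \<partial>\<^sub>2(u) v\<close> and \<open>b = \<partial>\<^sub>1(v) u + \<partial>\<^sub>2(v) v\<close> (lemma
  \<open>square_odd_field\<close>). It remains to compute \<open>V\<^sup>6 = E\<^sup>3\<close>. Its third-order coefficients are products of
  three factors \<open>a\<close> or \<open>b\<close>, hence vanish, since each term of \<open>a\<close> and \<open>b\<close> contains \<open>u\<close> or \<open>v\<close>. The
  second-order coefficients also vanish, by a cancellation between monomials that contain \<open>u\<close>,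
  \<open>v\<close> and the four first derivatives. So \<open>E\<^sup>3 = \<partial>\<^sub>1 E(E(a)) + \<partial>\<^sub>2 E(E(b))\<close> (lemma
  \<open>cube_square_field\<close>).

  Each monomial of \<open>E(E(a))\<close> and \<open>E(E(b))\<close> is a product of six linear forms in the \<open>\<theta>\<^sub>i\<close>, and such a
  product is a determinant times \<open>\<theta>\<^sub>1 \<cdots> \<theta>\<^sub>6\<close> (lemma \<open>prod_list_odd_form\<close>). Collecting the monomials
  yields the combination of determinants in the statement (lemmas \<open>along_square_twice_1\<close> and
  \<open>along_square_twice_2\<close>), and the factor \<open>\<theta>\<^sub>1 \<cdots> \<theta>\<^sub>6\<close> can be cancelled (lemma
  \<open>coeffwise_top_cancel\<close>).

  The generators are realized as exterior multiplications on functions from index sets to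
  polynomials. There both they and the differential operators are additive maps, so that the
  whole computation takes place in one associative ring.
\<close>


section \<open>Products of anticommuting elements\<close>

locale anticommuting =
  fixes \<theta> :: "'i \<Rightarrow> 'a::ring_1"
  assumes anticommute: "\<theta> i * \<theta> j = - (\<theta> j * \<theta> i)"
    and square_zero: "\<theta> i * \<theta> i = 0"
begin

lemma move_past: "prod_list (map \<theta> xs) * \<theta> j = (- 1) ^ length xs * (\<theta> j * prod_list (map \<theta> xs))"
proof (induction xs)
  case (Cons i xs)
  have "prod_list (map \<theta> (i # xs)) * \<theta> j = \<theta> i * ((- 1) ^ length xs * (\<theta> j * prod_list (map \<theta> xs)))"
    using Cons.IH by (simp add: mult.assoc)
  also have "\<dots> = (- 1) ^ length xs * ((\<theta> i * \<theta> j) * prod_list (map \<theta> xs))"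
    by (cases "even (length xs)") (simp_all add: mult.assoc)
  finally show ?case
    by (simp add: anticommute[of i j] mult.assoc)
qed simp

lemma prod_list_repeat:
  assumes "\<not> distinct xs"
  shows "prod_list (map \<theta> xs) = 0"
proof -
  obtain as bs cs j where xs: "xs = as @ [j] @ bs @ [j] @ cs"
    using not_distinct_decomp[OF assms] by blast
  have "\<theta> j * (prod_list (map \<theta> bs) * \<theta> j) = 0"
    unfolding move_past
    by (cases "even (length bs)") (simp_all add: mult.assoc[symmetric] square_zero)
  \<comment> \<open>The same with a trailing factor, so that it applies inside a right-nested product.\<close>
  then have "\<theta> j * (prod_list (map \<theta> bs) * (\<theta> j * z)) = 0" for z
    by (metis mult.assoc mult_zero_left)
  then show ?thesis
    by (simp add: xs mult.assoc)
qed

text \<open>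
  Carrying both elements past \<open>bs\<close> costs the same sign on either side of the equation, so the only
  sign left is the one from exchanging the two elements themselves.
\<close>

lemma prod_list_swap:
  "prod_list (map \<theta> (as @ j # bs @ i # cs)) = - prod_list (map \<theta> (as @ i # bs @ j # cs))"
proof -
  let ?B = "prod_list (map \<theta> bs)"
  have "\<theta> j * (?B * \<theta> i) = - (\<theta> i * (?B * \<theta> j))"
    unfolding move_past
    by (cases "even (length bs)") (simp_all add: mult.assoc[symmetric] anticommute[of i j])
  then have "\<theta> j * (?B * (\<theta> i * z)) = - (\<theta> i * (?B * (\<theta> j * z)))" for z
    by (metis mult.assoc mult_minus_left)
  then show ?thesis
    by (simp add: mult.assoc)
qed

lemma prod_list_transpose:
  assumes "distinct xs" "i \<in> set xs" "j \<in> set xs" "i \<noteq> j"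
  shows "prod_list (map (\<theta> \<circ> transpose i j) xs) = - prod_list (map \<theta> xs)"
proof -
  have ordered: "prod_list (map (\<theta> \<circ> transpose i j) xs) = - prod_list (map \<theta> xs)"
    if xs: "xs = as @ i # bs @ j # cs" for as bs cs i j
  proof -
    have fixed: "map (\<theta> \<circ> transpose i j) ys = map \<theta> ys" if "i \<notin> set ys" "j \<notin> set ys" for ys
      using that by (auto simp: transpose_def)
    have "map (\<theta> \<circ> transpose i j) xs = map \<theta> (as @ j # bs @ i # cs)"
      using assms(1) by (simp add: xs fixed del: map_map map_eq_conv)
    then have "prod_list (map (\<theta> \<circ> transpose i j) xs) = prod_list (map \<theta> (as @ j # bs @ i # cs))"
      by (rule arg_cong)
    also have "\<dots> = - prod_list (map \<theta> xs)"
      unfolding xs by (rule prod_list_swap)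
    finally show "prod_list (map (\<theta> \<circ> transpose i j) xs) = - prod_list (map \<theta> xs)" .
  qed
  obtain as bs where xs: "xs = as @ i # bs"
    using assms(2) by (auto simp: in_set_conv_decomp)
  then consider "j \<in> set as" | "j \<in> set bs"
    using assms(3,4) by auto
  then show ?thesis
  proof cases
    case 1
    then obtain as1 as2 where "as = as1 @ j # as2"
      by (auto simp: in_set_conv_decomp)
    then show ?thesis
      using ordered[of as1 j as2 i bs] xs by (simp add: transpose_commute)
  next
    case 2
    then obtain bs1 bs2 where "bs = bs1 @ j # bs2"
      by (auto simp: in_set_conv_decomp)
    then show ?thesis
      using ordered[of as i bs1 j bs2] xs by simp
  qed
qed

lemma reindex: "anticommuting (\<theta> \<circ> p)"
  by unfold_locales (simp_all add: square_zero flip: anticommute)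

end

text \<open>
  A permutation is a product of transpositions. The induction peels them off on the right, where
  each acts on the reindexed family \<open>\<theta> \<circ> p\<close>, which is again anticommuting.
\<close>

lemma (in anticommuting) prod_list_permute:
  assumes "p permutes set xs" "distinct xs"
  shows "prod_list (map (\<theta> \<circ> p) xs) = of_int (sign p) * prod_list (map \<theta> xs)"
  using finite_set[of xs] assms(1)
proof (induction rule: permutes_rev_induct)
  case (swap a b p)
  interpret p: anticommuting "\<theta> \<circ> p"
    by (rule reindex)
  have "permutation p"
    using swap.hyps by (meson finite_set permutation_permutes)
  then have "sign (p \<circ> transpose a b) = - sign p"
    using swap.hyps by (simp add: sign_compose permutation_swap_id sign_swap_id)
  moreover have "prod_list (map (\<theta> \<circ> (p \<circ> transpose a b)) xs) = - prod_list (map (\<theta> \<circ> p) xs)"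
    using p.prod_list_transpose[OF assms(2)] swap.hyps by (simp only: comp_assoc not_False_eq_True)
  ultimately show ?case
    using swap.IH by (simp only: of_int_minus mult_minus_left)
qed simp

text \<open>
  The distributive law for a product of sums in a ring that need not be commutative: the factors stay
  in the order of \<open>ks\<close>. The choice functions are made the identity off \<open>ks\<close>, so that those that
  permute \<open>set ks\<close> are permutations in the sense of \<^const>\<open>permutes\<close>.
\<close>

lemma prod_list_sum:
  fixes x :: "'i \<Rightarrow> 'i \<Rightarrow> 'a::ring_1"
  assumes "distinct ks" "finite S"
  shows "(\<Prod>k\<leftarrow>ks. \<Sum>i\<in>S. x k i) =
    (\<Sum>f | \<forall>k. if k \<in> set ks then f k \<in> S else f k = k. \<Prod>k\<leftarrow>ks. x k (f k))"
  using assms(1)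
proof (induction ks)
  case Nil
  have "{f. \<forall>k::'i. f k = k} = {id}" by auto
  then show ?case by simp
next
  case (Cons k ks)
  define F where "F = {f. \<forall>k. if k \<in> set ks then f k \<in> S else f k = k}"
  have "(\<Prod>k\<leftarrow>k # ks. \<Sum>i\<in>S. x k i) = (\<Sum>(i, f)\<in>S \<times> F. x k i * (\<Prod>k\<leftarrow>ks. x k (f k)))"
    using Cons by (simp add: F_def sum_product sum.cartesian_product)
  also have "\<dots> = (\<Sum>f | \<forall>j. if j \<in> set (k # ks) then f j \<in> S else f j = j. \<Prod>k\<leftarrow>k # ks. x k (f k))"
  proof (rule sum.reindex_bij_witness[of _ "\<lambda>f. (f k, f(k := k))" "\<lambda>(i, f). f(k := i)"], goal_cases)
    case (1 a)
    then show ?case using Cons.prems by (auto simp: F_def fun_eq_iff)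
  next
    case (2 a)
    then show ?case by (auto simp: F_def split: if_splits)
  next
    case (3 b)
    then show ?case by auto
  next
    case (4 b)
    then show ?case using Cons.prems by (auto simp: F_def)
  next
    case (5 a)
    obtain i f where a: "a = (i, f)"
      by (cases a)
    have "(\<Prod>j\<leftarrow>ks. x j (if j = k then i else f j)) = (\<Prod>j\<leftarrow>ks. x j (f j))"
      using Cons.prems by (intro arg_cong[of _ _ prod_list]) auto
    then show ?case by (simp add: a)
  qed
  finally show ?case .
qed

text \<open>
  This is the bridge between anticommuting generators and alternating sums. After expansion, a choice
  function that is not injective repeats a generator and contributes nothing; the others are
  permutations and contribute their sign. The coefficients need not commute with each other: with
  commuting coefficients the right-hand side is a determinant, and with coefficients \<open>c k i = X i\<close>
  it is the standard skew-symmetric polynomial of the \<open>X i\<close>.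
\<close>

lemma (in anticommuting) prod_list_linear_forms:
  assumes "distinct ks" and comm: "\<And>k i j. c k i * \<theta> j = \<theta> j * c k i"
  shows "(\<Prod>k\<leftarrow>ks. \<Sum>i\<in>set ks. c k i * \<theta> i) =
    (\<Sum>p | p permutes set ks. of_int (sign p) * (\<Prod>k\<leftarrow>ks. c k (p k))) * prod_list (map \<theta> ks)"
proof -
  define F where "F = {f. \<forall>k. if k \<in> set ks then f k \<in> set ks else f k = k}"
  have comm_prod: "(\<Prod>k\<leftarrow>xs. c k (f k)) * \<theta> j = \<theta> j * (\<Prod>k\<leftarrow>xs. c k (f k))" for xs f j
    by (induction xs) (simp_all add: mult.assoc comm, simp add: comm flip: mult.assoc)
  have separate: "(\<Prod>k\<leftarrow>xs. c k (f k) * \<theta> (f k)) = (\<Prod>k\<leftarrow>xs. c k (f k)) * prod_list (map (\<theta> \<circ> f) xs)"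
    for xs f
  proof (induction xs)
    case (Cons i xs)
    then show ?case
      by (simp add: mult.assoc) (simp add: comm_prod flip: mult.assoc)
  qed simp
  have "finite F"
  proof (rule finite_subset)
    show "F \<subseteq> (\<lambda>g k. if k \<in> set ks then g k else k) ` (set ks \<rightarrow>\<^sub>E set ks)"
    proof
      fix f assume f: "f \<in> F"
      have "f = (\<lambda>k. if k \<in> set ks then restrict f (set ks) k else k)"
        using f by (auto simp: F_def fun_eq_iff)
      moreover have "restrict f (set ks) \<in> set ks \<rightarrow>\<^sub>E set ks"
        using f by (auto simp: F_def)
      ultimately show "f \<in> (\<lambda>g k. if k \<in> set ks then g k else k) ` (set ks \<rightarrow>\<^sub>E set ks)"
        by blast
    qed
  qed (simp add: finite_PiE)
  have perm: "{p. p permutes set ks} \<subseteq> F"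
    using permutes_in_image permutes_not_in by (fastforce simp: F_def)
  have "(\<Prod>k\<leftarrow>ks. \<Sum>i\<in>set ks. c k i * \<theta> i) =
      (\<Sum>f\<in>F. (\<Prod>k\<leftarrow>ks. c k (f k)) * prod_list (map (\<theta> \<circ> f) ks))"
    unfolding F_def using assms(1) by (simp add: prod_list_sum separate)
  also have "\<dots> = (\<Sum>p | p permutes set ks. (\<Prod>k\<leftarrow>ks. c k (p k)) * prod_list (map (\<theta> \<circ> p) ks))"
  proof (rule sum.mono_neutral_right[OF \<open>finite F\<close> perm], rule ballI)
    fix f assume f: "f \<in> F - {p. p permutes set ks}"
    have "\<not> inj_on f (set ks)"
    proof
      assume "inj_on f (set ks)"
      moreover have "f ` set ks \<subseteq> set ks"
        using f by (auto simp: F_def)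
      ultimately have "bij_betw f (set ks) (set ks)"
        by (simp add: bij_betw_def endo_inj_surj)
      then show False
        using f bij_imp_permutes[of f "set ks"] by (auto simp: F_def split: if_splits)
    qed
    then have "\<not> distinct (map f ks)"
      by (simp add: distinct_map)
    then have "prod_list (map (\<theta> \<circ> f) ks) = 0"
      using prod_list_repeat by fastforce
    then show "(\<Prod>k\<leftarrow>ks. c k (f k)) * prod_list (map (\<theta> \<circ> f) ks) = 0"
      by simp
  qed
  also have "\<dots> = (\<Sum>p | p permutes set ks. of_int (sign p) * (\<Prod>k\<leftarrow>ks. c k (p k)) * prod_list (map \<theta> ks))"
  proof (rule sum.cong[OF refl])
    fix p assume "p \<in> {p. p permutes set ks}"
    then show "(\<Prod>k\<leftarrow>ks. c k (p k)) * prod_list (map (\<theta> \<circ> p) ks) =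
        of_int (sign p) * (\<Prod>k\<leftarrow>ks. c k (p k)) * prod_list (map \<theta> ks)"
      using assms(1) prod_list_permute by (simp add: sign_def)
  qed
  finally show ?thesis
    by (simp add: sum_distrib_right)
qed

lemma sum_skew:
  fixes a :: "'i \<Rightarrow> 'i \<Rightarrow> 'a::ab_group_add"
  assumes "\<And>i j. a i j = - a j i" "\<And>i. a i i = 0"
  shows "(\<Sum>i\<in>S. \<Sum>j\<in>S. a i j) = 0"
proof (induction S rule: infinite_finite_induct)
  case (insert x S)
  have "(\<Sum>i\<in>S. a i x) = - (\<Sum>i\<in>S. a x i)"
    unfolding sum_negf[symmetric] by (rule sum.cong[OF refl assms(1)])
  then show ?case
    using insert by (simp add: sum.distrib assms(2))
qed simp_all

text \<open>
  Linear forms in the generators with commuting coefficients are again odd elements. Their squares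
  vanish by pairing off the terms \<open>(i, j)\<close> and \<open>(j, i)\<close>, which avoids dividing by 2.
\<close>

lemma (in anticommuting) linear_forms:
  assumes comm: "\<And>r i j. c r i * \<theta> j = \<theta> j * c r i"
    and comm_c: "\<And>r s i j. c r i * c s j = c s j * c r i"
  shows "anticommuting (\<lambda>r. \<Sum>i\<in>S. c r i * \<theta> i)"
proof
  have pair: "c r i * \<theta> i * (c s j * \<theta> j) = c r i * c s j * (\<theta> i * \<theta> j)" for r s i j
    by (metis comm mult.assoc)
  have skew: "c r i * \<theta> i * (c s j * \<theta> j) = - (c s j * \<theta> j * (c r i * \<theta> i))" for r s i j
    unfolding pair by (simp add: anticommute[of i j] comm_c[of r i])
  show "(\<Sum>i\<in>S. c r i * \<theta> i) * (\<Sum>i\<in>S. c s i * \<theta> i) =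
      - ((\<Sum>i\<in>S. c s i * \<theta> i) * (\<Sum>i\<in>S. c r i * \<theta> i))" for r s
    unfolding sum_product sum_negf[symmetric]
    by (subst sum.swap) (intro sum.cong refl skew)
  show "(\<Sum>i\<in>S. c r i * \<theta> i) * (\<Sum>i\<in>S. c r i * \<theta> i) = 0" for r
    unfolding sum_product by (rule sum_skew[OF skew]) (simp add: pair square_zero)
qed


section \<open>The sixth power of an odd vector field in two variables\<close>

text \<open>
  The symbols \<open>\<partial>\<^sub>1\<^sup>a \<partial>\<^sub>2\<^sup>b u\<^sub>j\<close> are treated as odd variables \<open>e ((a, b), j)\<close> in a ring that also contains the
  two derivations. The relation of \<open>e\<close> with \<open>D1\<close> and \<open>D2\<close> is the Leibniz rule in the convention
  that the left factor acts first.
\<close>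

locale odd_jets = anticommuting e
  for e :: "diff_symbol \<Rightarrow> 'a::ring_1" +
  fixes D1 D2 :: 'a
  assumes D_commute: "D2 * D1 = D1 * D2"
    and jet_D1: "e ((a, b), j) * D1 = D1 * e ((a, b), j) + e ((a + 1, b), j)"
    and jet_D2: "e ((a, b), j) * D2 = D2 * e ((a, b), j) + e ((a, b + 1), j)"
begin

definition der1 :: "'a \<Rightarrow> 'a" where "der1 x = x * D1 - D1 * x"
definition der2 :: "'a \<Rightarrow> 'a" where "der2 x = x * D2 - D2 * x"

lemma mult_D1: "x * D1 = D1 * x + der1 x" and mult_D2: "x * D2 = D2 * x + der2 x"
  by (simp_all add: der1_def der2_def)

lemma der_simps:
  "der1 (x + y) = der1 x + der1 y" "der2 (x + y) = der2 x + der2 y"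
  "der1 (x - y) = der1 x - der1 y" "der2 (x - y) = der2 x - der2 y"
  "der1 (- x) = - der1 x" "der2 (- x) = - der2 x"
  "der1 (x * y) = der1 x * y + x * der1 y" "der2 (x * y) = der2 x * y + x * der2 y"
  "der1 0 = 0" "der2 0 = 0"
  "der1 (e ((a, b), j)) = e ((a + 1, b), j)" "der2 (e ((a, b), j)) = e ((a, b + 1), j)"
  by (simp_all add: der1_def der2_def jet_D1 jet_D2 algebra_simps)

text \<open>
  The coefficients of the even vector field \<open>D1 * square_coeff 1 + D2 * square_coeff 2\<close>, which is the
  square of the odd vector field with components \<open>e ((0, 0), 1)\<close> and \<open>e ((0, 0), 2)\<close>;
  \<open>along_square\<close> differentiates along this square.
\<close>

definition square_coeff :: "nat \<Rightarrow> 'a" where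
  "square_coeff j = e ((1, 0), j) * e ((0, 0), 1) + e ((0, 1), j) * e ((0, 0), 2)"

definition along_square :: "'a \<Rightarrow> 'a" where
  "along_square x = der1 x * square_coeff 1 + der2 x * square_coeff 2"

text \<open>
  The rank only orients the rule \<open>e \<rho> * e \<sigma> = - (e \<sigma> * e \<rho>)\<close>: with it, rewriting sorts every
  monomial in the odd variables. The underived variables come first, so that a monomial
  with more than two of them is quickly recognized as zero. The weights separate the
  symbols of order at most 3, the only ones that occur.
\<close>

fun rank :: "diff_symbol \<Rightarrow> nat" where
  "rank ((a, b), j) = 100 * (a + b) + 10 * j + b"

lemma sort_jets:
  "rank \<sigma> < rank \<rho> \<Longrightarrow> e \<rho> * e \<sigma> = - (e \<sigma> * e \<rho>)"
  "rank \<sigma> < rank \<rho> \<Longrightarrow> e \<rho> * (e \<sigma> * z) = - (e \<sigma> * (e \<rho> * z))"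
  "e \<rho> * e \<rho> = 0"
  "e \<rho> * (e \<rho> * z) = 0"
  by (simp_all add: anticommute[of \<rho> \<sigma>] square_zero flip: mult.assoc)

lemmas jet_simps = along_square_def square_coeff_def der_simps sort_jets distrib_left distrib_right
  left_diff_distrib right_diff_distrib mult.assoc

text \<open>
  The second-order part of the square has the coefficients \<open>u * u\<close>, \<open>u * v + v * u\<close> and \<open>v * v\<close>,
  which vanish because \<open>u\<close> and \<open>v\<close> are odd.
\<close>

lemma square_odd_field:
  "(D1 * e ((0, 0), 1) + D2 * e ((0, 0), 2))\<^sup>2 = D1 * square_coeff 1 + D2 * square_coeff 2"
proof -
  define u v where "u = e ((0, 0), 1)" and "v = e ((0, 0), 2)"
  have comm': "D2 * (D1 * x) = D1 * (D2 * x)" for x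
    using D_commute by (metis mult.assoc)
  have "(D1 * u + D2 * v)\<^sup>2 =
      D1 * (u * D1) * u + D1 * (u * D2) * v + D2 * (v * D1) * u + D2 * (v * D2) * v"
    by (simp add: power2_eq_square algebra_simps)
  also have "\<dots> = D1 * D1 * (u * u) + D1 * D2 * (u * v + v * u) + D2 * D2 * (v * v)
      + D1 * (der1 u * u + der2 u * v) + D2 * (der1 v * u + der2 v * v)"
    unfolding mult_D1[of u] mult_D1[of v] mult_D2[of u] mult_D2[of v]
    using comm' by (simp add: algebra_simps)
  finally show ?thesis
    by (simp add: u_def v_def jet_simps)
qed

text \<open>
  Every term of \<open>square_coeff j\<close> contains an underived variable, and there are only two of these;
  a product of three terms repeats one of them.
\<close>

lemma cubic_zero:
  "square_coeff i * square_coeff j * square_coeff k = 0"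
  by (simp add: jet_simps)

text \<open>
  These coefficients form the second-order part of the cube. Two factors \<open>square_coeff\<close> already
  use up both underived variables, so every term with a second derivative, which brings another one,
  vanishes. A monomial that survives is, up to sign, the product of the underived variables and all
  four first derivatives, and these signs cancel.
\<close>

lemma quadratic_zero:
  "along_square (square_coeff 1 * square_coeff 1) + along_square (square_coeff 1) * square_coeff 1 = 0"
  "along_square (square_coeff 1 * square_coeff 2 + square_coeff 2 * square_coeff 1)
    + along_square (square_coeff 1) * square_coeff 2 + along_square (square_coeff 2) * square_coeff 1 = 0"
  "along_square (square_coeff 2 * square_coeff 2) + along_square (square_coeff 2) * square_coeff 2 = 0"
  by (simp_all add: jet_simps)

text \<open>
  Moving all derivations to the left splits the cube by the order of differentiation. Orders 3 and 2
  vanish by the two preceding lemmas; in order 1 the coefficients of the first factor are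
  differentiated along the other two.
\<close>

lemma cube_square_field:
  "(D1 * square_coeff 1 + D2 * square_coeff 2) ^ 3 =
    D1 * along_square (along_square (square_coeff 1)) + D2 * along_square (along_square (square_coeff 2))"
proof -
  define a b where "a = square_coeff 1" and "b = square_coeff 2"
  define V where "V = D1 * a + D2 * b"
  define E where "E x = der1 x * a + der2 x * b" for x
  have comm': "D2 * (D1 * x) = D1 * (D2 * x)" for x
    using D_commute by (metis mult.assoc)
  \<comment> \<open>Composition with \<open>V\<close> either raises the order of differentiation or differentiates the
    coefficient \<open>x\<close> along \<open>V\<close>.\<close>
  have step: "x * V = D1 * (x * a) + D2 * (x * b) + E x" for x
  proof -
    have "x * V = (x * D1) * a + (x * D2) * b"
      by (simp add: V_def algebra_simps)
    then show ?thesis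
      unfolding mult_D1[of x] mult_D2[of x] by (simp add: E_def algebra_simps)
  qed
  have "V * V = D1 * (a * V) + D2 * (b * V)"
    by (simp add: V_def algebra_simps)
  also have "\<dots> =
      D1 * (D1 * (a * a)) + D1 * (D2 * (a * b + b * a)) + D2 * (D2 * (b * b)) + D1 * E a + D2 * E b"
    unfolding step by (simp add: algebra_simps comm')
  finally have "V ^ 3 =
      (D1 * (D1 * (a * a)) + D1 * (D2 * (a * b + b * a)) + D2 * (D2 * (b * b)) + D1 * E a + D2 * E b) * V"
    by (simp add: power3_eq_cube)
  also have "\<dots> = D1 * (D1 * ((a * a) * V)) + D1 * (D2 * ((a * b + b * a) * V))
      + D2 * (D2 * ((b * b) * V)) + D1 * (E a * V) + D2 * (E b * V)"
    by (simp add: algebra_simps)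
  also have "\<dots> =
      D1 * (D1 * (D1 * (a * a * a))) + D1 * (D1 * (D2 * (a * a * b + a * b * a + b * a * a)))
      + D1 * (D2 * (D2 * (a * b * b + b * a * b + b * b * a))) + D2 * (D2 * (D2 * (b * b * b)))
      + D1 * (D1 * (E (a * a) + E a * a)) + D1 * (D2 * (E (a * b + b * a) + E a * b + E b * a))
      + D2 * (D2 * (E (b * b) + E b * b)) + D1 * E (E a) + D2 * E (E b)"
    unfolding step by (simp add: algebra_simps comm')
  also have "\<dots> = D1 * E (E a) + D2 * E (E b)"
  proof -
    have E: "E x = along_square x" for x
      by (simp add: E_def a_def b_def along_square_def)
    show ?thesis
      unfolding E a_def b_def using cubic_zero quadratic_zero by simp
  qed
  finally show ?thesis
    by (simp add: V_def a_def b_def E_def along_square_def)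
qed

definition jet_product :: "diff_symbol \<Rightarrow> diff_symbol \<Rightarrow> diff_symbol \<Rightarrow> diff_symbol \<Rightarrow> 'a" where
  "jet_product \<rho>\<^sub>3 \<rho>\<^sub>4 \<rho>\<^sub>5 \<rho>\<^sub>6 = e ((0, 0), 1) * e ((0, 0), 2) * e \<rho>\<^sub>3 * e \<rho>\<^sub>4 * e \<rho>\<^sub>5 * e \<rho>\<^sub>6"

definition jet_product' :: "diff_symbol \<Rightarrow> diff_symbol \<Rightarrow> diff_symbol \<Rightarrow> diff_symbol \<Rightarrow> 'a" where
  "jet_product' \<rho>\<^sub>3 \<rho>\<^sub>4 \<rho>\<^sub>5 \<rho>\<^sub>6 = e ((0, 0), 2) * e ((0, 0), 1) * e \<rho>\<^sub>3 * e \<rho>\<^sub>4 * e \<rho>\<^sub>5 * e \<rho>\<^sub>6"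

lemma mult_3_left: "3 * x = x + x + x" for x :: 'a
  using distrib_right[of 1 2 x] by (simp add: mult_2 algebra_simps)

text \<open>
  Both sides are brought to a sum of sorted monomials. Numerical factors are written as repeated sums,
  because the terms on the left-hand side arise one at a time.
\<close>

lemma along_square_twice_1:
  "along_square (along_square (square_coeff 1)) =
           - jet_product ((0, 1), 1) ((1, 0), 2) ((0, 1), 2) ((0, 2), 2)
           - jet_product ((1, 0), 1) ((0, 1), 1) ((0, 1), 2) ((2, 0), 1)
           - jet_product ((1, 0), 1) ((0, 1), 1) ((1, 0), 2) ((0, 2), 2)
           + 2 * jet_product ((0, 1), 1) ((1, 0), 2) ((0, 1), 2) ((1, 1), 1)
           + 2 * jet_product ((1, 0), 1) ((0, 1), 1) ((1, 0), 2) ((1, 1), 1)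
           + 2 * jet_product ((1, 0), 1) ((0, 1), 1) ((0, 1), 2) ((1, 1), 2)
           - 3 * jet_product ((1, 0), 1) ((1, 0), 2) ((0, 1), 2) ((0, 2), 1)"
  by (simp add: jet_simps jet_product_def mult_2 mult_3_left) (simp add: algebra_simps numeral_2_eq_2)

lemma along_square_twice_2:
  "along_square (along_square (square_coeff 2)) =
           - jet_product' ((1, 0), 2) ((0, 1), 1) ((1, 0), 1) ((2, 0), 1)
           - jet_product' ((0, 1), 2) ((1, 0), 2) ((1, 0), 1) ((0, 2), 2)
           - jet_product' ((0, 1), 2) ((1, 0), 2) ((0, 1), 1) ((2, 0), 1)
           + 2 * jet_product' ((1, 0), 2) ((0, 1), 1) ((1, 0), 1) ((1, 1), 2)
           + 2 * jet_product' ((0, 1), 2) ((1, 0), 2) ((0, 1), 1) ((1, 1), 2)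
           + 2 * jet_product' ((0, 1), 2) ((1, 0), 2) ((1, 0), 1) ((1, 1), 1)
           - 3 * jet_product' ((0, 1), 2) ((0, 1), 1) ((1, 0), 1) ((2, 0), 2)"
  by (simp add: jet_simps jet_product'_def mult_2 mult_3_left) (simp add: algebra_simps numeral_2_eq_2)

end


section \<open>Exterior multiplication and differential operators as endomorphisms\<close>

text \<open>
  As in \<^typ>\<open>diff2\<close>, the left factor of a product of endomorphisms acts first. The maps
  respect the additive structure; taking \<open>'a\<close> to be a ring ensures \<open>0 \<noteq> 1\<close> for them.
\<close>

typedef (overloaded) 'a endo = "{T :: 'a::ring_1 \<Rightarrow> 'a. \<forall>x y. T (x + y) = T x + T y}"
  morphisms act Endo
  by (rule exI[of _ id]) simp

setup_lifting type_definition_endo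

instantiation endo :: (ring_1) ring_1
begin

lift_definition zero_endo :: "'a endo" is "\<lambda>x. 0" by simp
lift_definition one_endo :: "'a endo" is "\<lambda>x. x" by simp
lift_definition plus_endo :: "'a endo \<Rightarrow> 'a endo \<Rightarrow> 'a endo" is "\<lambda>T U x. T x + U x"
  by (simp add: algebra_simps)
lift_definition uminus_endo :: "'a endo \<Rightarrow> 'a endo" is "\<lambda>T x. - T x" by simp
lift_definition minus_endo :: "'a endo \<Rightarrow> 'a endo \<Rightarrow> 'a endo" is "\<lambda>T U x. T x - U x"
  by (simp add: algebra_simps)
lift_definition times_endo :: "'a endo \<Rightarrow> 'a endo \<Rightarrow> 'a endo" is "\<lambda>T U x. U (T x)" by simp

instance
proof
  show "(0 :: 'a endo) \<noteq> 1"
    by transfer (metis one_neq_zero)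
qed (transfer; auto simp: fun_eq_iff)+

end

text \<open>
  A function \<open>g\<close> on sets stands for the exterior form \<open>\<Sum>S. g S \<cdot> e\<^sub>S\<close>, with \<open>e\<^sub>S\<close> the product of the
  basis elements with index in \<open>S\<close>. The operator \<open>creation i\<close> multiplies a form by
  the \<open>i\<close>-th basis element; the sign counts the basis elements that it passes.
  Only indices below \<open>i\<close> are counted, which are finitely many even if \<open>S\<close> is infinite. Realizing
  exterior multiplication by operators makes associativity automatic, and lets the odd variables live
  in the same ring as the differential operators.
\<close>

lift_definition creation :: "nat \<Rightarrow> (nat set \<Rightarrow> 'a::ring_1) endo" is
  "\<lambda>i g S. if i \<in> S then (- 1) ^ card {j \<in> S. j < i} * g (S - {i}) else 0"
  by (auto simp: fun_eq_iff algebra_simps)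

definition coeffwise :: "diff2 \<Rightarrow> (nat set \<Rightarrow> poly2) endo" where
  "coeffwise X = Endo (\<lambda>g S. apply_diff X (g S))"

lemma act_coeffwise: "act (coeffwise X) g S = apply_diff X (g S)"
  by (simp add: coeffwise_def Endo_inverse Diff2_additive[OF apply_diff] fun_eq_iff)

lemma act_endo_simps:
  "act (T + U) g = act T g + act U g"
  "act (T - U) g = act T g - act U g"
  "act (- T) g = - act T g"
  "act 0 g = 0"
  "act 1 g = g"
  "act (T * U) g = act U (act T g)"
  by (transfer, simp)+

lemma act_creation:
  "act (creation i) g S = (if i \<in> S then (- 1) ^ card {j \<in> S. j < i} * g (S - {i}) else 0)"
  by transfer simp

interpretation creation: anticommuting "creation :: nat \<Rightarrow> (nat set \<Rightarrow> 'a::ring_1) endo"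
proof
  \<comment> \<open>Removing \<open>i\<close> lowers the number of indices below \<open>j\<close> by one, but removing \<open>j\<close> does not change
    the number of indices below \<open>i\<close>: this is where the two orders differ by a sign.\<close>
  have less: "creation i * creation j = - (creation j * creation i :: (nat set \<Rightarrow> 'a) endo)" if "i < j" for i j
  proof -
    have "act (creation i * creation j) g S = act (- (creation j * creation i)) g S"
      for g :: "nat set \<Rightarrow> 'a" and S
    proof (cases "i \<in> S \<and> j \<in> S")
      case True
      have "{k \<in> S. k < j} = insert i {k \<in> S. k \<noteq> i \<and> k < j}"
        using that True by auto
      then have "card {k \<in> S. k < j} = Suc (card {k \<in> S. k \<noteq> i \<and> k < j})"
        by simp
      moreover have "{k \<in> S. k \<noteq> j \<and> k < i} = {k \<in> S. k < i}"
        using that by auto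
      moreover have "S - {i} - {j} = S - {j} - {i}"
        by auto
      ultimately show ?thesis
        using that True
        by (simp add: act_endo_simps act_creation add.commute flip: mult.assoc power_add)
    qed (auto simp: act_endo_simps act_creation)
    then show ?thesis
      by (simp add: act_inject[symmetric] fun_eq_iff)
  qed
  show square: "creation i * creation i = (0 :: (nat set \<Rightarrow> 'a) endo)" for i
    by (simp add: act_inject[symmetric] fun_eq_iff act_endo_simps act_creation)
  show "creation i * creation j = - (creation j * creation i :: (nat set \<Rightarrow> 'a) endo)" for i j
    using less[of i j] less[of j i] square[of i] by (cases i j rule: linorder_cases) simp_all
qed

lemma coeffwise_hom:
  "coeffwise (X + Y) = coeffwise X + coeffwise Y"
  "coeffwise (X - Y) = coeffwise X - coeffwise Y"
  "coeffwise (- X) = - coeffwise X"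
  "coeffwise (X * Y) = coeffwise X * coeffwise Y"
  "coeffwise 0 = 0"
  "coeffwise 1 = 1"
  by (simp_all add: act_inject[symmetric] fun_eq_iff act_endo_simps act_coeffwise)

lemma coeffwise_sum: "coeffwise (sum X I) = (\<Sum>i\<in>I. coeffwise (X i))"
  by (induction I rule: infinite_finite_induct) (simp_all add: coeffwise_hom)

lemma coeffwise_prod_list: "coeffwise (prod_list Xs) = prod_list (map coeffwise Xs)"
  by (induction Xs) (simp_all add: coeffwise_hom)

lemma coeffwise_sign: "coeffwise (of_int (sign p)) = of_int (sign p)"
  by (simp add: sign_def coeffwise_hom)

lemma apply_diff_zero [simp]: "apply_diff X 0 = 0"
  by (rule Diff2_at_0[OF apply_diff])

lemma apply_diff_uminus: "apply_diff X (- f) = - apply_diff X f"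
proof -
  have "apply_diff X (- f) + apply_diff X f = 0"
    using Diff2_additive[OF apply_diff, of X "- f" f] by simp
  then show ?thesis
    by (simp add: add_eq_0_iff2)
qed

lemma coeffwise_creation: "coeffwise X * creation i = creation i * coeffwise X"
proof -
  have "apply_diff X ((- 1) ^ n * f) = (- 1) ^ n * apply_diff X f" for n f
    by (cases "even n") (simp_all add: apply_diff_uminus)
  then show ?thesis
    by (simp add: act_inject[symmetric] fun_eq_iff act_endo_simps act_creation act_coeffwise)
qed

lemma act_top_creation:
  "act (prod_list (map creation [1..<Suc n])) g {1..n} = (- 1) ^ (\<Sum>{..<n}) * (g {} :: 'a::ring_1)"
proof (induction n)
  case 0
  then show ?case by (simp add: act_endo_simps)
next
  case (Suc n)
  have "{j \<in> {1..Suc n}. j < Suc n} = {1..n}" "{1..Suc n} - {Suc n} = {1..n}"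
    by auto
  then show ?case
    using Suc by (simp add: act_endo_simps act_creation add.commute flip: power_add mult.assoc)
qed

text \<open>
  The product of the first \<open>n\<close> generators is not a zero divisor against differential operators:
  applied to a constant form, it places the value of the operator, up to a fixed sign,
  at the index set \<open>{1..n}\<close>. Hence identities between differential operators
  can be proved after multiplication by it.
\<close>

lemma coeffwise_top_cancel:
  assumes "coeffwise X * prod_list (map creation [1..<Suc n]) = coeffwise Y * prod_list (map creation [1..<Suc n])"
  shows "X = Y"
proof (rule diff2_eqI)
  fix f
  have *: "act (coeffwise Z * prod_list (map creation [1..<Suc n])) (\<lambda>_. f) {1..n} =
      (- 1) ^ (\<Sum>{..<n}) * apply_diff Z f" for Z
    unfolding act_endo_simps act_top_creation act_coeffwise ..
  show "apply_diff X f = apply_diff Y f"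
    using *[of X] *[of Y] assms by (cases "even (\<Sum>{..<n})") simp_all
qed


section \<open>Odd linear forms and determinants\<close>

definition multiplier :: "poly2 \<Rightarrow> (nat set \<Rightarrow> poly2) endo" where
  "multiplier p = coeffwise (p *\<^sub>D 1)"

lemma multiplier_hom:
  "multiplier (p + q) = multiplier p + multiplier q"
  "multiplier (p - q) = multiplier p - multiplier q"
  "multiplier (- p) = - multiplier p"
  "multiplier (p * q) = multiplier p * multiplier q"
  "multiplier 0 = 0"
  "multiplier 1 = 1"
  unfolding multiplier_def coeffwise_hom[symmetric]
  by (rule arg_cong[where f = coeffwise], rule diff2_eqI, simp add: algebra_simps)+

lemma multiplier_sum: "multiplier (sum p I) = (\<Sum>i\<in>I. multiplier (p i))"
  by (induction I rule: infinite_finite_induct) (simp_all add: multiplier_hom)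

lemma multiplier_prod_list: "multiplier (prod_list ps) = prod_list (map multiplier ps)"
  by (induction ps) (simp_all add: multiplier_hom)

lemma multiplier_sign: "multiplier (of_int (sign p)) = of_int (sign p)"
  by (simp add: sign_def multiplier_hom)

lemma multiplier_numeral: "multiplier (numeral k) = numeral k"
proof -
  have "multiplier (of_nat n) = of_nat n" for n
    by (induction n) (simp_all add: multiplier_hom)
  from this[of "numeral k"] show ?thesis
    by simp
qed

lemma multiplier_commute: "multiplier p * multiplier q = multiplier q * multiplier p"
  by (simp add: mult.commute flip: multiplier_hom)

lemma multiplier_creation: "multiplier p * creation i = creation i * multiplier p"
  unfolding multiplier_def by (rule coeffwise_creation)

lemma multiplier_D:
  "multiplier p * coeffwise \<partial>\<^sub>1 = coeffwise \<partial>\<^sub>1 * multiplier p + multiplier (pd1 p)"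
  "multiplier p * coeffwise \<partial>\<^sub>2 = coeffwise \<partial>\<^sub>2 * multiplier p + multiplier (pd2 p)"
  unfolding multiplier_def coeffwise_hom[symmetric]
  by (rule arg_cong[where f = coeffwise], rule diff2_eqI, simp add: pd1_mult pd2_mult)+

lemma coeffwise_scale_D:
  "coeffwise (p *\<^sub>D \<partial>\<^sub>1) = coeffwise \<partial>\<^sub>1 * multiplier p"
  "coeffwise (p *\<^sub>D \<partial>\<^sub>2) = coeffwise \<partial>\<^sub>2 * multiplier p"
  unfolding multiplier_def coeffwise_hom[symmetric]
  by (rule arg_cong[where f = coeffwise], rule diff2_eqI, simp)+

abbreviation top_creation :: "nat \<Rightarrow> (nat set \<Rightarrow> poly2) endo" where
  "top_creation n \<equiv> prod_list (map creation [1..<Suc n])"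

definition odd_form :: "nat \<Rightarrow> (nat \<Rightarrow> poly2) \<Rightarrow> (nat set \<Rightarrow> poly2) endo" where
  "odd_form n r = (\<Sum>i\<in>{1..n}. multiplier (r i) * creation i)"

lemma anticommuting_odd_form: "anticommuting (odd_form n)"
  using creation.linear_forms[of "\<lambda>r i. multiplier (r i)" "{1..n}"]
  by (simp add: odd_form_def[abs_def] multiplier_creation multiplier_commute)

lemma odd_form_D:
  "odd_form n r * coeffwise \<partial>\<^sub>1 = coeffwise \<partial>\<^sub>1 * odd_form n r + odd_form n (\<lambda>i. pd1 (r i))"
  "odd_form n r * coeffwise \<partial>\<^sub>2 = coeffwise \<partial>\<^sub>2 * odd_form n r + odd_form n (\<lambda>i. pd2 (r i))"
proof -
  have swap: "multiplier p * creation i * coeffwise Y = multiplier p * coeffwise Y * creation i" for p i Y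
    by (simp add: mult.assoc coeffwise_creation)
  have "multiplier p * creation i * coeffwise \<partial>\<^sub>1 =
        coeffwise \<partial>\<^sub>1 * (multiplier p * creation i) + multiplier (pd1 p) * creation i"
    and "multiplier p * creation i * coeffwise \<partial>\<^sub>2 =
        coeffwise \<partial>\<^sub>2 * (multiplier p * creation i) + multiplier (pd2 p) * creation i" for p i
    unfolding swap multiplier_D by (simp_all only: distrib_right mult.assoc)
  then show "odd_form n r * coeffwise \<partial>\<^sub>1 = coeffwise \<partial>\<^sub>1 * odd_form n r + odd_form n (\<lambda>i. pd1 (r i))"
    and "odd_form n r * coeffwise \<partial>\<^sub>2 = coeffwise \<partial>\<^sub>2 * odd_form n r + odd_form n (\<lambda>i. pd2 (r i))"
    by (simp_all only: odd_form_def sum_distrib_left sum_distrib_right sum.distrib)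
qed

text \<open>
  For coefficients from \<open>\<complex>[x\<^sub>1, x\<^sub>2]\<close>, which commute, the alternating sum in the expansion of a product
  of linear forms is the Leibniz formula for the determinant. Thus determinants are traded for
  products, in which rows can be permuted and repeated rows discarded by rewriting.
\<close>

lemma prod_list_odd_form:
  assumes "length rs = n"
  shows "prod_list (map (odd_form n) rs) =
    multiplier (det (mat_of_rows_list n (map (\<lambda>r. map r [1..<Suc n]) rs))) * top_creation n"
    (is "_ = multiplier (det ?A) * _")
proof -
  \<comment> \<open>Matrix indices start at 0, generators at 1.\<close>
  interpret shifted: anticommuting "creation \<circ> Suc :: nat \<Rightarrow> (nat set \<Rightarrow> poly2) endo"
    by (rule creation.reindex)
  have comm: "multiplier p * (creation \<circ> Suc) i = (creation \<circ> Suc) i * multiplier p" for p i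
    by (simp add: multiplier_creation)
  have dim: "dim_row ?A = n" "dim_col ?A = n"
    using assms by (simp_all add: mat_of_rows_list_def)
  have entry: "?A $$ (k, i) = (rs ! k) (Suc i)" if "k < n" "i < n" for k i
    using that assms by (simp add: mat_of_rows_list_def del: upt_Suc)
  have "map (odd_form n) rs = map (\<lambda>k. odd_form n (rs ! k)) [0..<n]"
    by (rule nth_equalityI) (simp_all add: assms)
  also have "\<dots> = map (\<lambda>k. \<Sum>i\<in>set [0..<n]. multiplier ((rs ! k) (Suc i)) * (creation \<circ> Suc) i) [0..<n]"
    by (simp add: odd_form_def sum.atLeast1_atMost_eq atLeast0LessThan)
  finally have "prod_list (map (odd_form n) rs) =
      (\<Sum>p | p permutes set [0..<n]. of_int (sign p) *
        (\<Prod>k\<leftarrow>[0..<n]. multiplier ((rs ! k) (Suc (p k))))) * prod_list (map (creation \<circ> Suc) [0..<n])"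
    by (simp only: shifted.prod_list_linear_forms[OF distinct_upt comm])
  moreover have "map (creation \<circ> Suc :: nat \<Rightarrow> (nat set \<Rightarrow> poly2) endo) [0..<n] = map creation [1..<Suc n]"
    by (simp add: map_Suc_upt flip: map_map del: upt_Suc)
  moreover have "(\<Sum>p | p permutes set [0..<n]. of_int (sign p) *
        (\<Prod>k\<leftarrow>[0..<n]. multiplier ((rs ! k) (Suc (p k))))) = multiplier (det ?A)"
  proof -
    have "det ?A = (\<Sum>p | p permutes {0..<n}. of_int (sign p) * (\<Prod>k = 0..<n. ?A $$ (k, p k)))"
      by (simp only: det_def dim if_True simp_thms)
    also have "\<dots> = (\<Sum>p | p permutes {0..<n}. of_int (sign p) * (\<Prod>k = 0..<n. (rs ! k) (Suc (p k))))"
    proof (intro sum.cong refl arg_cong2[where f = "(*)"] prod.cong)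
      fix p k assume "p \<in> {p. p permutes {0..<n}}" "k \<in> {0..<n}"
      then have "k < n" "p k < n"
        using permutes_in_image[of p "{0..<n}" k] by simp_all
      then show "?A $$ (k, p k) = (rs ! k) (Suc (p k))"
        by (rule entry)
    qed
    also have "\<dots> = (\<Sum>p | p permutes set [0..<n]. of_int (sign p) * (\<Prod>k\<leftarrow>[0..<n]. (rs ! k) (Suc (p k))))"
      by (simp add: prod.distinct_set_conv_list[of "[0..<n]", simplified])
    finally show ?thesis
      by (simp only: multiplier_sum multiplier_hom multiplier_sign multiplier_prod_list map_map comp_def)
  qed
  ultimately show ?thesis
    by (simp only:)
qed

definition jet :: "(nat \<Rightarrow> nat \<Rightarrow> poly2) \<Rightarrow> diff_symbol \<Rightarrow> (nat set \<Rightarrow> poly2) endo" where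
  "jet u \<rho> = odd_form 6 (\<lambda>i. pd (fst \<rho>) (u i (snd \<rho>)))"

interpretation jet: odd_jets "jet u" "coeffwise \<partial>\<^sub>1" "coeffwise \<partial>\<^sub>2" for u
proof -
  have "anticommuting (odd_form 6 \<circ> (\<lambda>\<rho> i. pd (fst \<rho>) (u i (snd \<rho>))))"
    by (rule anticommuting.reindex[OF anticommuting_odd_form])
  moreover have "coeffwise \<partial>\<^sub>2 * coeffwise \<partial>\<^sub>1 = coeffwise \<partial>\<^sub>1 * coeffwise \<partial>\<^sub>2"
    unfolding coeffwise_hom[symmetric]
    by (rule arg_cong[where f = coeffwise], rule diff2_eqI, simp add: pd1_pd2)
  ultimately show "odd_jets (jet u) (coeffwise \<partial>\<^sub>1) (coeffwise \<partial>\<^sub>2)"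
    by (simp add: odd_jets_def odd_jets_axioms_def jet_def[abs_def] comp_def odd_form_D pd1_pd pd2_pd)
qed

lemma jet_product_eq_Delta:
  "jet.jet_product u \<rho>\<^sub>3 \<rho>\<^sub>4 \<rho>\<^sub>5 \<rho>\<^sub>6 = multiplier (Delta u \<rho>\<^sub>3 \<rho>\<^sub>4 \<rho>\<^sub>5 \<rho>\<^sub>6) * top_creation 6"
  "jet.jet_product' u \<rho>\<^sub>3 \<rho>\<^sub>4 \<rho>\<^sub>5 \<rho>\<^sub>6 = multiplier (Delta' u \<rho>\<^sub>3 \<rho>\<^sub>4 \<rho>\<^sub>5 \<rho>\<^sub>6) * top_creation 6"
proof -
  define row where "row \<rho> = (\<lambda>i. pd (fst \<rho>) (u i (snd \<rho>)))" for \<rho>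
  have jet: "jet u \<rho> = odd_form 6 (row \<rho>)" for \<rho>
    by (simp add: jet_def row_def)
  have rows: "map (\<lambda>i. u i j) [1..<7] = map (row ((0, 0), j)) [1..<7]" "symbol_row u \<rho> = map (row \<rho>) [1..<7]"
    for j \<rho>
    by (simp_all add: row_def symbol_row_def)
  have seven: "Suc 6 = 7"
    by simp
  show "jet.jet_product u \<rho>\<^sub>3 \<rho>\<^sub>4 \<rho>\<^sub>5 \<rho>\<^sub>6 = multiplier (Delta u \<rho>\<^sub>3 \<rho>\<^sub>4 \<rho>\<^sub>5 \<rho>\<^sub>6) * top_creation 6"
    using prod_list_odd_form[of "map row [((0, 0), 1), ((0, 0), 2), \<rho>\<^sub>3, \<rho>\<^sub>4, \<rho>\<^sub>5, \<rho>\<^sub>6]" 6]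
    unfolding Delta_def rows jet.jet_product_def jet seven
    by (simp only: list.map prod_list.Cons prod_list.Nil mult_1_right mult.assoc list.size)
  show "jet.jet_product' u \<rho>\<^sub>3 \<rho>\<^sub>4 \<rho>\<^sub>5 \<rho>\<^sub>6 = multiplier (Delta' u \<rho>\<^sub>3 \<rho>\<^sub>4 \<rho>\<^sub>5 \<rho>\<^sub>6) * top_creation 6"
    using prod_list_odd_form[of "map row [((0, 0), 2), ((0, 0), 1), \<rho>\<^sub>3, \<rho>\<^sub>4, \<rho>\<^sub>5, \<rho>\<^sub>6]" 6]
    unfolding Delta'_def rows jet.jet_product'_def jet seven
    by (simp only: list.map prod_list.Cons prod_list.Nil mult_1_right mult.assoc list.size)
qed

text \<open>
  The six generators separate the six fields: in the sixth power of \<open>\<Sum>i. X i \<theta>\<^sub>i\<close> only the terms that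
  use each \<open>X i\<close> once survive, with the sign of their order.
\<close>

lemma s6_as_power:
  "coeffwise (s6 X) * top_creation 6 = (\<Sum>i\<in>{1..6}. coeffwise (X i) * creation i) ^ 6"
proof -
  have list: "[1..<Suc 6] = [1, 2, 3, 4, 5, 6 :: nat]"
    by (simp add: upt_rec)
  have set: "set [1..<Suc 6] = {1..6 :: nat}"
    by auto
  have "s6 X = (\<Sum>p | p permutes set [1..<Suc 6]. of_int (sign p) * (\<Prod>k\<leftarrow>[1..<Suc 6]. X (p k)))"
    unfolding s6_def set
    by (simp only: list list.map prod_list.Cons prod_list.Nil mult_1_right mult.assoc)
  then have "coeffwise (s6 X) =
      (\<Sum>p | p permutes set [1..<Suc 6]. of_int (sign p) * (\<Prod>k\<leftarrow>[1..<Suc 6]. coeffwise (X (p k))))"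
    by (simp only: coeffwise_sum coeffwise_hom coeffwise_sign coeffwise_prod_list map_map comp_def)
  then have "coeffwise (s6 X) * top_creation 6 =
      (\<Prod>k\<leftarrow>[1..<Suc 6]. \<Sum>i\<in>set [1..<Suc 6]. coeffwise (X i) * creation i)"
    by (simp only: creation.prod_list_linear_forms[OF distinct_upt coeffwise_creation])
  then show ?thesis
    by (simp only: set map_replicate_const prod_list_replicate length_upt) simp
qed


section \<open>The skew-symmetric sum of six vector fields\<close>

theorem theorem10p1:
  fixes u :: "nat \<Rightarrow> nat \<Rightarrow> poly2"
    and X :: "nat \<Rightarrow> diff2"
  assumes "\<And>i. i \<in> {1..6} \<Longrightarrow> X i = u i 1 *\<^sub>D \<partial>\<^sub>1 + u i 2 *\<^sub>D \<partial>\<^sub>2"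
  shows "let
      F\<^sub>1 = - Delta u ((0, 1), 1) ((1, 0), 2) ((0, 1), 2) ((0, 2), 2)
           - Delta u ((1, 0), 1) ((0, 1), 1) ((0, 1), 2) ((2, 0), 1)
           - Delta u ((1, 0), 1) ((0, 1), 1) ((1, 0), 2) ((0, 2), 2)
           + 2 * Delta u ((0, 1), 1) ((1, 0), 2) ((0, 1), 2) ((1, 1), 1)
           + 2 * Delta u ((1, 0), 1) ((0, 1), 1) ((1, 0), 2) ((1, 1), 1)
           + 2 * Delta u ((1, 0), 1) ((0, 1), 1) ((0, 1), 2) ((1, 1), 2)
           - 3 * Delta u ((1, 0), 1) ((1, 0), 2) ((0, 1), 2) ((0, 2), 1);
      F\<^sub>2 = - Delta' u ((1, 0), 2) ((0, 1), 1) ((1, 0), 1) ((2, 0), 1)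
           - Delta' u ((0, 1), 2) ((1, 0), 2) ((1, 0), 1) ((0, 2), 2)
           - Delta' u ((0, 1), 2) ((1, 0), 2) ((0, 1), 1) ((2, 0), 1)
           + 2 * Delta' u ((1, 0), 2) ((0, 1), 1) ((1, 0), 1) ((1, 1), 2)
           + 2 * Delta' u ((0, 1), 2) ((1, 0), 2) ((0, 1), 1) ((1, 1), 2)
           + 2 * Delta' u ((0, 1), 2) ((1, 0), 2) ((1, 0), 1) ((1, 1), 1)
           - 3 * Delta' u ((0, 1), 2) ((0, 1), 1) ((1, 0), 1) ((2, 0), 2)
    in s6 X = F\<^sub>1 *\<^sub>D \<partial>\<^sub>1 + F\<^sub>2 *\<^sub>D \<partial>\<^sub>2"
proof -
  let ?D1 = "coeffwise \<partial>\<^sub>1" and ?D2 = "coeffwise \<partial>\<^sub>2"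
  have "(\<Sum>i\<in>{1..6}. coeffwise (X i) * creation i) =
      ?D1 * jet u ((0, 0), 1) + ?D2 * jet u ((0, 0), 2)"
    by (simp add: assms coeffwise_hom coeffwise_scale_D jet_def odd_form_def distrib_right sum.distrib
        sum_distrib_left mult.assoc)
  then have "coeffwise (s6 X) * top_creation 6 =
      ((?D1 * jet u ((0, 0), 1) + ?D2 * jet u ((0, 0), 2))\<^sup>2) ^ 3"
    by (simp only: s6_as_power power_mult[symmetric]) simp
  also have "\<dots> = ?D1 * jet.along_square u (jet.along_square u (jet.square_coeff u 1))
      + ?D2 * jet.along_square u (jet.along_square u (jet.square_coeff u 2))"
    unfolding jet.square_odd_field by (rule jet.cube_square_field)
  finally have power: "coeffwise (s6 X) * top_creation 6 = \<dots>" .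
  show ?thesis
    unfolding Let_def
    by (rule coeffwise_top_cancel[of _ 6],
        unfold power jet.along_square_twice_1 jet.along_square_twice_2 jet_product_eq_Delta)
      (simp only: coeffwise_hom coeffwise_scale_D multiplier_hom multiplier_numeral
        distrib_right left_diff_distrib mult_minus_left mult.assoc)
qed

end
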